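(* Let $(\mu,\vec w_1,\vec w_2)$ be a perfect combination of a measure and two systems of weights on an interval $\Delta\subset\mathbb{R}$, let $\vec n_1\in\mathbb{N}^{p_1}$ and $\vec n_2\in\mathbb{N}^{p_2}$ be compositions, and let $g=S^{-1}\bar S$ be the Gauss--Borel factorization of the associated moment matrix. Let $Q^{(k)}$, $\bar Q^{(k)}$ ($k\ge 0$) be the associated linear forms and dual linear forms, $J$ the Jacobi type matrix, and $K^{[l]}(x,y)=\sum_{k=0}^{l-1}Q^{(k)}(y)\bar Q^{(k)}(x)$ the Christoffel--Darboux kernel (all as defined in the context). Then for every integer $l\geq \max\{|\vec n_1|,|\vec n_2|\}$ and all $x,y\in\Delta$, $$(y-x)K^{[l]}(x,y)=\sum_{(i,j)\in \sigma_1[l]}\bar{Q}^{(j)}(x)\, J_{j,i}\, Q^{(i)}(y)-\sum_{(i,j)\in\sigma_2[l]}\bar{Q}^{(j)}(x)\, J_{j,i}\, Q^{(i)}(y),$$ where $$\sigma_1[l]:=\big\{l,\dots, (l)_{\{+,r_1(a_1(l)-1)\}}\big\}\times \big\{(l-1)_{\{-,r_1(a_1(l-1)+1)\}},\dots,l-1\big\},$$ $$\sigma_2[l]:=\big\{(l-1)_{\{-,r_2(a_2(l-1)+1)\}},\dots,l-1\big\}\times\big\{l,\dots,(l)_{\{+,r_2(a_2(l)-1)\}}\big\}.$$ Here $\{m,\dots,m'\}$ denotes the set of all integers $k$ with $m\le k\le m'$.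
   Context: **Measure and weights.** $\Delta\subset\mathbb{R}$ is an interval, and $\mu$ is a finite positive Borel measure whose support contains infinitely many points of $\Delta$. For $\alpha=1,2$, $\vec w_\alpha=(w_{\alpha,1},\dots,w_{\alpha,p_\alpha})$, $p_\alpha\in\mathbb{N}$, is a system of real integrable functions on $\Delta$ that do not change sign on $\Delta$. All moments $\int_\Delta x^j w_{1,a}(x)w_{2,b}(x)\,d\mu(x)$, $j\ge 0$, are assumed finite. **Perfect combination.** $(\mu,\vec w_1,\vec w_2)$ is perfect if for all multi-indices $\vec\nu_1\in\mathbb{Z}_+^{p_1}$, $\vec\nu_2\in\mathbb{Z}_+^{p_2}$ ($\mathbb{Z}_+=\{0,1,2,\dots\}$) with $|\vec\nu_1|=|\vec\nu_2|+1$, where $|\cdot|$ is the sum of the components, the following holds. Whenever $A_1,\dots,A_{p_1}$ are polynomials, not all zero, with $\deg A_a\le\nu_{1,a}-1$ and $$\int_\Delta \sum_{a=1}^{p_1}A_a(x)w_{1,a}(x)w_{2,b}(x)x^j\,d\mu(x)=0,\qquad 0\le j\le\nu_{2,b}-1,\ b=1,\dots,p_2,$$ one has $\deg A_a=\nu_{1,a}-1$ for all $a$ (with the zero polynomial having degree $-1$ when $\nu_{1,a}=0$). **Index bookkeeping.** For $\alpha=1,2$, $\vec n_\alpha=(n_{\alpha,1},\dots,n_{\alpha,p_\alpha})$ has positive integer entries and $|\vec n_\alpha|=\sum_a n_{\alpha,a}$. Every $l\in\mathbb{Z}_+$ determines unique integers $k_\alpha(l)\ge 0$, $a_\alpha(l)\in\{1,\dots,p_\alpha\}$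 and $0\le \rho_\alpha(l)<n_{\alpha,a_\alpha(l)}$ such that $$l=k_\alpha(l)|\vec n_\alpha|+\sum_{i=1}^{a_\alpha(l)-1}n_{\alpha,i}+\rho_\alpha(l).$$ Call $a_\alpha(l)$ the $\alpha$-type of $l$. For $a\in\{1,\dots,p_\alpha\}$, $l_{\{+,a\}}$ is the smallest integer $\ge l$ whose $\alpha$-type is $a$, and $l_{\{-,a\}}$ is the largest integer in $\{0,\dots,l\}$ whose $\alpha$-type is $a$. The value of $\alpha$ is the one indicated by the subscripts of the functions in the second slot; e.g. in $(l)_{\{+,r_1(a_1(l)-1)\}}$ one uses $\alpha=1$. For an integer $m$, $r_\alpha(m)$ is the unique element of $\{1,\dots,p_\alpha\}$ congruent to $m$ modulo $p_\alpha$. **Moment matrix.** $\xi_\alpha(x)$ is the semi-infinite column vector with entries, for $l=0,1,2,\dots$, $$\xi_\alpha^{(l)}(x)=w_{\alpha,a_\alpha(l)}(x)\,x^{k_\alpha(l)n_{\alpha,a_\alpha(l)}+\rho_\alpha(l)}.$$ The moment matrix is the semi-infinite matrix $g=\int_\Delta \xi_1(x)\xi_2(x)^\top d\mu(x)$, with rows and columns indexed from $0$. **Factorization.** $g=S^{-1}\bar S$, where $S$ is a real lower triangular semi-infinite matrix with ones on the diagonal and $\bar S$ is a real invertible upper triangular semi-infinite matrix. For a perfect combination this factorization exists and is unique. **Linear forms.** $Q=(Q^{(0)},Q^{(1)},\dots)^\top:=S\xi_1$ and $\bar Q=(\bar Q^{(0)},\bar Q^{(1)},\dots)^\top:=(\bar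 S^{-1})^\top\xi_2$. **Jacobi type matrix.** $\Upsilon_\alpha$ is the semi-infinite matrix with entries $(\Upsilon_\alpha)_{l,j}=\delta_{j,(l+1)_{\{+,a_\alpha(l)\}}}$. It satisfies $\Upsilon_\alpha\xi_\alpha(x)=x\xi_\alpha(x)$ and $\Upsilon_1 g=g\Upsilon_2^\top$. Define $J:=S\Upsilon_1S^{-1}=\bar S\Upsilon_2^\top\bar S^{-1}$, where the two expressions agree because of $\Upsilon_1 g=g\Upsilon_2^\top$. *)

theory Defs
  imports
    "HOL-Analysis.Analysis"
    "HOL-Computational_Algebra.Computational_Algebra"
    "HOL-Number_Theory.Cong"
begin

section \<open>Measure and weights\<close>

definition measure_support :: "real measure \<Rightarrow> real set" where
  "measure_support \<mu> = {x. \<forall>U. open U \<longrightarrow> x \<in> U \<longrightarrow> emeasure \<mu> U > 0}"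

text \<open>The measure lives on the whole real line; all integrals below are taken over \<open>\<Delta>\<close>.\<close>

definition admissible_measure :: "real set \<Rightarrow> real measure \<Rightarrow> bool" where
  "admissible_measure \<Delta> \<mu> \<longleftrightarrow>
     is_interval \<Delta> \<and> sets \<mu> = sets borel \<and> finite_measure \<mu> \<and>
     infinite (measure_support \<mu> \<inter> \<Delta>)"

text \<open>A system of \<open>p\<close> weights is a function \<open>w\<close> of which only \<open>w 1, \<dots>, w p\<close> matter; multi-indices,
  compositions and systems of polynomials are treated in the same way.\<close>

definition admissible_weights ::
  "real set \<Rightarrow> real measure \<Rightarrow> nat \<Rightarrow> (nat \<Rightarrow> real \<Rightarrow> real) \<Rightarrow> bool" where
  "admissible_weights \<Delta> \<mu> p w \<longleftrightarrow>
     (\<forall>a\<in>{1..p}. set_integrable \<mu> \<Delta> (w a) \<and>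
        ((\<forall>x\<in>\<Delta>. 0 \<le> w a x) \<or> (\<forall>x\<in>\<Delta>. w a x \<le> 0)))"

definition finite_moments ::
  "real set \<Rightarrow> real measure \<Rightarrow> nat \<Rightarrow> (nat \<Rightarrow> real \<Rightarrow> real) \<Rightarrow> nat \<Rightarrow> (nat \<Rightarrow> real \<Rightarrow> real) \<Rightarrow> bool" where
  "finite_moments \<Delta> \<mu> p1 w1 p2 w2 \<longleftrightarrow>
     (\<forall>a\<in>{1..p1}. \<forall>b\<in>{1..p2}. \<forall>j. set_integrable \<mu> \<Delta> (\<lambda>x. x ^ j * w1 a x * w2 b x))"

definition isize :: "nat \<Rightarrow> (nat \<Rightarrow> nat) \<Rightarrow> nat" where
  "isize p n = (\<Sum>a = 1..p. n a)"

text \<open>Degree with the convention that the zero polynomial has degree \<open>-1\<close>.\<close>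

definition deg :: "real poly \<Rightarrow> int" where
  "deg P = (if P = 0 then - 1 else int (degree P))"

definition perfect ::
  "real set \<Rightarrow> real measure \<Rightarrow> nat \<Rightarrow> (nat \<Rightarrow> real \<Rightarrow> real) \<Rightarrow> nat \<Rightarrow> (nat \<Rightarrow> real \<Rightarrow> real) \<Rightarrow> bool" where
  "perfect \<Delta> \<mu> p1 w1 p2 w2 \<longleftrightarrow>
     (\<forall>\<nu>1 \<nu>2 :: nat \<Rightarrow> nat. isize p1 \<nu>1 = isize p2 \<nu>2 + 1 \<longrightarrow>
       (\<forall>A :: nat \<Rightarrow> real poly.
          (\<exists>a\<in>{1..p1}. A a \<noteq> 0) \<longrightarrow>
          (\<forall>a\<in>{1..p1}. deg (A a) \<le> int (\<nu>1 a) - 1) \<longrightarrow>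
          (\<forall>b\<in>{1..p2}. \<forall>j<\<nu>2 b.
             (LINT x:\<Delta>|\<mu>. (\<Sum>a = 1..p1. poly (A a) x * w1 a x * w2 b x * x ^ j)) = 0) \<longrightarrow>
          (\<forall>a\<in>{1..p1}. deg (A a) = int (\<nu>1 a) - 1)))"

definition composition :: "nat \<Rightarrow> (nat \<Rightarrow> nat) \<Rightarrow> bool" where
  "composition p n \<longleftrightarrow> (\<forall>a\<in>{1..p}. n a > 0)"


section \<open>Index bookkeeping\<close>

definition index_decomp :: "nat \<Rightarrow> (nat \<Rightarrow> nat) \<Rightarrow> nat \<Rightarrow> nat \<times> nat \<times> nat" where
  "index_decomp p n l = (THE (k, a, \<rho>). a \<in> {1..p} \<and> \<rho> < n a \<and>
     l = k * isize p n + (\<Sum>i = 1..<a. n i) + \<rho>)"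

definition ind_k :: "nat \<Rightarrow> (nat \<Rightarrow> nat) \<Rightarrow> nat \<Rightarrow> nat" where
  "ind_k p n l = fst (index_decomp p n l)"

definition ind_a :: "nat \<Rightarrow> (nat \<Rightarrow> nat) \<Rightarrow> nat \<Rightarrow> nat" where
  "ind_a p n l = fst (snd (index_decomp p n l))"

definition ind_\<rho> :: "nat \<Rightarrow> (nat \<Rightarrow> nat) \<Rightarrow> nat \<Rightarrow> nat" where
  "ind_\<rho> p n l = snd (snd (index_decomp p n l))"

definition next_idx :: "nat \<Rightarrow> (nat \<Rightarrow> nat) \<Rightarrow> nat \<Rightarrow> nat \<Rightarrow> nat" where
  "next_idx p n l a = (LEAST m. l \<le> m \<and> ind_a p n m = a)"

text \<open>Only meaningful if some index in \<open>{0..l}\<close> has type \<open>a\<close>, e.g. if \<open>l + 1 \<ge> isize p n\<close>.\<close>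

definition prev_idx :: "nat \<Rightarrow> (nat \<Rightarrow> nat) \<Rightarrow> nat \<Rightarrow> nat \<Rightarrow> nat" where
  "prev_idx p n l a = (GREATEST m. m \<le> l \<and> ind_a p n m = a)"

definition cyc :: "nat \<Rightarrow> int \<Rightarrow> nat" where
  "cyc p m = (THE i. i \<in> {1..p} \<and> [int i = m] (mod int p))"


section \<open>Semi-infinite matrices\<close>

type_synonym smat = "nat \<Rightarrow> nat \<Rightarrow> real"

text \<open>Entries of products are series; for the products formed below every such series has only
  finitely many nonzero terms.\<close>

definition smat_mult :: "smat \<Rightarrow> smat \<Rightarrow> smat" (infixl "\<odot>" 70) where
  "A \<odot> B = (\<lambda>i j. \<Sum>k. A i k * B k j)"

definition smat_vec :: "smat \<Rightarrow> (nat \<Rightarrow> real) \<Rightarrow> nat \<Rightarrow> real" where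
  "smat_vec A v = (\<lambda>i. \<Sum>k. A i k * v k)"

definition smat_one :: smat where
  "smat_one = (\<lambda>i j. if i = j then 1 else 0)"

definition smat_transpose :: "smat \<Rightarrow> smat" where
  "smat_transpose A = (\<lambda>i j. A j i)"

definition smat_is_inverse :: "smat \<Rightarrow> smat \<Rightarrow> bool" where
  "smat_is_inverse A B \<longleftrightarrow> A \<odot> B = smat_one \<and> B \<odot> A = smat_one"

definition smat_invertible :: "smat \<Rightarrow> bool" where
  "smat_invertible A \<longleftrightarrow> (\<exists>B. smat_is_inverse A B)"

text \<open>Two-sided inverses of general semi-infinite matrices need not be unique, but they are for
  lower unitriangular and for invertible upper triangular matrices: in the first case the columns of
  a right inverse, in the second the rows of a left inverse, are determined recursively.\<close>

definition smat_inv :: "smat \<Rightarrow> smat" where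
  "smat_inv A = (THE B. smat_is_inverse A B)"

definition lower_unitriangular :: "smat \<Rightarrow> bool" where
  "lower_unitriangular A \<longleftrightarrow> (\<forall>i. A i i = 1) \<and> (\<forall>i j. i < j \<longrightarrow> A i j = 0)"

definition upper_triangular :: "smat \<Rightarrow> bool" where
  "upper_triangular A \<longleftrightarrow> (\<forall>i j. j < i \<longrightarrow> A i j = 0)"

definition gauss_borel :: "smat \<Rightarrow> smat \<Rightarrow> smat \<Rightarrow> bool" where
  "gauss_borel g S Sb \<longleftrightarrow> lower_unitriangular S \<and> upper_triangular Sb \<and> smat_invertible Sb \<and>
     g = smat_inv S \<odot> Sb"


section \<open>Moment matrix, linear forms, Jacobi type matrix, kernel\<close>

definition xi :: "nat \<Rightarrow> (nat \<Rightarrow> real \<Rightarrow> real) \<Rightarrow> (nat \<Rightarrow> nat) \<Rightarrow> real \<Rightarrow> nat \<Rightarrow> real" where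
  "xi p w n x l =
     w (ind_a p n l) x * x ^ (ind_k p n l * n (ind_a p n l) + ind_\<rho> p n l)"

definition moment_matrix ::
  "real set \<Rightarrow> real measure \<Rightarrow> nat \<Rightarrow> (nat \<Rightarrow> real \<Rightarrow> real) \<Rightarrow> (nat \<Rightarrow> nat) \<Rightarrow>
   nat \<Rightarrow> (nat \<Rightarrow> real \<Rightarrow> real) \<Rightarrow> (nat \<Rightarrow> nat) \<Rightarrow> smat" where
  "moment_matrix \<Delta> \<mu> p1 w1 n1 p2 w2 n2 =
     (\<lambda>i j. LINT x:\<Delta>|\<mu>. xi p1 w1 n1 x i * xi p2 w2 n2 x j)"

definition lin_form ::
  "nat \<Rightarrow> (nat \<Rightarrow> real \<Rightarrow> real) \<Rightarrow> (nat \<Rightarrow> nat) \<Rightarrow> smat \<Rightarrow> nat \<Rightarrow> real \<Rightarrow> real" where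
  "lin_form p1 w1 n1 S k x = smat_vec S (xi p1 w1 n1 x) k"

definition dual_form ::
  "nat \<Rightarrow> (nat \<Rightarrow> real \<Rightarrow> real) \<Rightarrow> (nat \<Rightarrow> nat) \<Rightarrow> smat \<Rightarrow> nat \<Rightarrow> real \<Rightarrow> real" where
  "dual_form p2 w2 n2 Sb k x = smat_vec (smat_transpose (smat_inv Sb)) (xi p2 w2 n2 x) k"

definition shift_matrix :: "nat \<Rightarrow> (nat \<Rightarrow> nat) \<Rightarrow> smat" where
  "shift_matrix p n = (\<lambda>l j. if j = next_idx p n (l + 1) (ind_a p n l) then 1 else 0)"

definition jacobi :: "nat \<Rightarrow> (nat \<Rightarrow> nat) \<Rightarrow> smat \<Rightarrow> smat" where
  "jacobi p1 n1 S = S \<odot> shift_matrix p1 n1 \<odot> smat_inv S"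

definition CD_kernel ::
  "(nat \<Rightarrow> real \<Rightarrow> real) \<Rightarrow> (nat \<Rightarrow> real \<Rightarrow> real) \<Rightarrow> nat \<Rightarrow> real \<Rightarrow> real \<Rightarrow> real" where
  "CD_kernel Q Qb l x y = (\<Sum>k<l. Q k y * Qb k x)"

definition sigma1 :: "nat \<Rightarrow> (nat \<Rightarrow> nat) \<Rightarrow> nat \<Rightarrow> (nat \<times> nat) set" where
  "sigma1 p1 n1 l =
     {l .. next_idx p1 n1 l (cyc p1 (int (ind_a p1 n1 l) - 1))} \<times>
     {prev_idx p1 n1 (l - 1) (cyc p1 (int (ind_a p1 n1 (l - 1)) + 1)) .. l - 1}"

definition sigma2 :: "nat \<Rightarrow> (nat \<Rightarrow> nat) \<Rightarrow> nat \<Rightarrow> (nat \<times> nat) set" where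
  "sigma2 p2 n2 l =
     {prev_idx p2 n2 (l - 1) (cyc p2 (int (ind_a p2 n2 (l - 1)) + 1)) .. l - 1} \<times>
     {l .. next_idx p2 n2 l (cyc p2 (int (ind_a p2 n2 l) - 1))}"

end

theory Submission
  imports Defs
begin

text \<open>Both \<open>J\<close> and its transpose have the form \<open>A \<odot> \<Upsilon> \<odot> B\<close> with \<open>A\<close>, \<open>B\<close> lower triangular and mutually
  inverse: \<open>J = S \<odot> \<Upsilon>\<^sub>1 \<odot> S\<inverse>\<close> by definition, and \<open>J = Sb \<odot> \<Upsilon>\<^sub>2\<^sup>T \<odot> Sb\<inverse>\<close> because multiplication by
  \<open>x\<close> may be moved between the two factors in the moment matrix. Hence \<open>J Q(y) = y Q(y)\<close> and
  \<open>J\<^sup>T Qb(x) = x Qb(x)\<close>. In \<open>y K - x K\<close> the entries of \<open>J\<close> with both indices below \<open>l\<close> cancel,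
  and the remaining ones vanish outside the index rectangles, since \<open>\<Upsilon>\<close> sends an index only to the
  next one of the same type, and between two consecutive visits to one type all others are met.\<close>

section \<open>Products of semi-infinite matrices\<close>

text \<open>Finite rows in the left factor turn every entry of a product into a finite sum. Lower
  triangular matrices and shift matrices have them, and products inherit them.\<close>

definition row_finite :: "smat \<Rightarrow> bool" where
  "row_finite A \<longleftrightarrow> (\<forall>i. finite {k. A i k \<noteq> 0})"

definition lower_triangular :: "smat \<Rightarrow> bool" where
  "lower_triangular A \<longleftrightarrow> (\<forall>i j. i < j \<longrightarrow> A i j = 0)"

lemma suminf_mult_eq_sum:
  fixes a b :: "nat \<Rightarrow> real"
  assumes "finite F" and "\<And>k. a k \<noteq> 0 \<Longrightarrow> b k \<noteq> 0 \<Longrightarrow> k \<in> F"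
  shows "(\<Sum>k. a k * b k) = (\<Sum>k\<in>F. a k * b k)"
  by (rule suminf_finite) (use assms in auto)

lemma lower_triangular_row_finite:
  assumes "lower_triangular A" shows "row_finite A"
proof -
  have "{k. A i k \<noteq> 0} \<subseteq> {..i}" for i
    using assms unfolding lower_triangular_def by (auto simp: not_less [symmetric])
  then show ?thesis
    unfolding row_finite_def by (meson finite_atMost finite_subset)
qed

lemma lower_triangular_mult:
  assumes "lower_triangular A"
  shows "(A \<odot> B) i j = (\<Sum>k\<le>i. A i k * B k j)"
  unfolding smat_mult_def
  by (rule suminf_mult_eq_sum) (use assms in \<open>auto simp: lower_triangular_def not_less [symmetric]\<close>)

lemma mult_nonzeroE:
  assumes "row_finite A" and "(A \<odot> B) i j \<noteq> 0"
  obtains k where "A i k \<noteq> 0" and "B k j \<noteq> 0"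
proof -
  have "(A \<odot> B) i j = (\<Sum>k | A i k \<noteq> 0. A i k * B k j)"
    unfolding smat_mult_def
    by (rule suminf_mult_eq_sum) (use assms in \<open>auto simp: row_finite_def\<close>)
  with assms(2) have "\<exists>k. A i k * B k j \<noteq> 0"
    by (metis (no_types, lifting) sum.neutral)
  then show thesis using that by auto
qed

lemma row_finite_mult:
  assumes "row_finite A" and "row_finite B"
  shows "row_finite (A \<odot> B)"
  unfolding row_finite_def
proof
  fix i
  have "{j. (A \<odot> B) i j \<noteq> 0} \<subseteq> (\<Union>k\<in>{k. A i k \<noteq> 0}. {j. B k j \<noteq> 0})"
    using mult_nonzeroE [OF assms(1)] by blast
  then show "finite {j. (A \<odot> B) i j \<noteq> 0}"
    by (rule finite_subset) (use assms in \<open>auto simp: row_finite_def\<close>)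
qed

text \<open>For a fixed entry both summation indices range over finite sets, so the sums may be
  swapped. The second alternative is for middle factors whose rows may be infinite, such as the
  moment matrix and \<open>Sb\<close>; there the columns of \<open>C\<close> bound the inner
  index.\<close>

lemma smat_mult_assoc:
  assumes A: "row_finite A" and BC: "row_finite B \<or> row_finite (smat_transpose C)"
  shows "(A \<odot> B) \<odot> C = A \<odot> (B \<odot> C)"
proof (intro ext)
  fix i l
  let ?F = "{k. A i k \<noteq> 0}"
  have F: "finite ?F" using A by (auto simp: row_finite_def)
  obtain G where G: "finite G" "\<And>k j. A i k \<noteq> 0 \<Longrightarrow> B k j \<noteq> 0 \<Longrightarrow> C j l \<noteq> 0 \<Longrightarrow> j \<in> G"
  proof (cases "row_finite B")
    case True
    then have "finite (\<Union>k\<in>?F. {j. B k j \<noteq> 0})" using F by (auto simp: row_finite_def)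
    then show thesis by (rule that) blast
  next
    case False
    with BC have "finite {j. C j l \<noteq> 0}" by (auto simp: row_finite_def smat_transpose_def)
    then show thesis by (rule that) blast
  qed
  have AB: "(A \<odot> B) i j = (\<Sum>k\<in>?F. A i k * B k j)" for j
    unfolding smat_mult_def by (rule suminf_mult_eq_sum [OF F]) auto
  have "((A \<odot> B) \<odot> C) i l = (\<Sum>j\<in>G. (A \<odot> B) i j * C j l)"
    unfolding smat_mult_def [of "A \<odot> B"]
  proof (rule suminf_mult_eq_sum [OF G(1)])
    fix j assume "(A \<odot> B) i j \<noteq> 0" and "C j l \<noteq> 0"
    then show "j \<in> G" using mult_nonzeroE [OF A] G(2) by metis
  qed
  also have "\<dots> = (\<Sum>k\<in>?F. A i k * (\<Sum>j\<in>G. B k j * C j l))"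
    unfolding AB sum_distrib_left sum_distrib_right
    by (subst sum.swap) (simp add: mult.assoc)
  also have "\<dots> = (\<Sum>k\<in>?F. A i k * (B \<odot> C) k l)"
  proof (rule sum.cong [OF refl])
    fix k assume "k \<in> ?F"
    then have "(B \<odot> C) k l = (\<Sum>j\<in>G. B k j * C j l)"
      unfolding smat_mult_def by (intro suminf_mult_eq_sum [OF G(1)]) (use G(2) in auto)
    then show "A i k * (\<Sum>j\<in>G. B k j * C j l) = A i k * (B \<odot> C) k l" by simp
  qed
  also have "\<dots> = (A \<odot> (B \<odot> C)) i l"
    unfolding smat_mult_def [of A] by (rule suminf_mult_eq_sum [OF F, symmetric]) auto
  finally show "((A \<odot> B) \<odot> C) i l = (A \<odot> (B \<odot> C)) i l" .
qed

lemma smat_transpose_mult: "smat_transpose (A \<odot> B) = smat_transpose B \<odot> smat_transpose A"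
  by (simp add: smat_transpose_def smat_mult_def mult.commute)

lemma smat_transpose_transpose [simp]: "smat_transpose (smat_transpose A) = A"
  by (simp add: smat_transpose_def)

lemma smat_transpose_one [simp]: "smat_transpose smat_one = smat_one"
  by (intro ext) (auto simp: smat_transpose_def smat_one_def)

lemma smat_one_mult [simp]: "smat_one \<odot> A = A"
proof (intro ext)
  fix i j
  have "(\<Sum>k. smat_one i k * A k j) = (\<Sum>k\<in>{i}. smat_one i k * A k j)"
    by (rule suminf_mult_eq_sum) (auto simp: smat_one_def split: if_splits)
  then show "(smat_one \<odot> A) i j = A i j" by (simp add: smat_mult_def smat_one_def)
qed

lemma smat_mult_one [simp]: "A \<odot> smat_one = A"
  by (metis smat_one_mult smat_transpose_mult smat_transpose_one smat_transpose_transpose)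

text \<open>The vector becomes a matrix with all columns equal, so matrix-vector products inherit
  associativity.\<close>

lemma smat_vec_eq_mult: "smat_vec A v i = (A \<odot> (\<lambda>k _. v k)) i j"
  by (simp add: smat_vec_def smat_mult_def)

lemma smat_vec_mult:
  assumes "row_finite A" and "row_finite B"
  shows "smat_vec (A \<odot> B) v = smat_vec A (smat_vec B v)"
proof
  fix i
  have "(\<lambda>k _. smat_vec B v k) = B \<odot> (\<lambda>k _. v k)"
    by (intro ext) (rule smat_vec_eq_mult)
  then show "smat_vec (A \<odot> B) v i = smat_vec A (smat_vec B v) i"
    using assms by (simp add: smat_vec_eq_mult [of _ _ _ 0] smat_mult_assoc)
qed

lemma smat_vec_scale:
  assumes "row_finite A"
  shows "smat_vec A (\<lambda>k. c * v k) i = c * smat_vec A v i"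
proof -
  have F: "finite {k. A i k \<noteq> 0}" using assms by (auto simp: row_finite_def)
  show ?thesis
    unfolding smat_vec_def by (subst (1 2) suminf_mult_eq_sum [OF F])
      (auto simp: sum_distrib_left mult_ac)
qed

section \<open>Inverses of triangular matrices\<close>

text \<open>Forward substitution: row \<open>i\<close> of \<open>S \<odot> B = smat_one\<close>,
  with \<open>S i i = 1\<close>, solved for row \<open>i\<close> of \<open>B\<close>.\<close>

fun lower_inverse :: "smat \<Rightarrow> smat" where
  "lower_inverse S i j = (if i = j then 1 else 0) - (\<Sum>k<i. S i k * lower_inverse S k j)"

declare lower_inverse.simps [simp del]

lemma lower_unitriangular_lower_inverse: "lower_unitriangular (lower_inverse S)"
proof -
  have *: "lower_inverse S i j = (if i = j then 1 else 0)" if "i \<le> j" for i j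
    using that
  proof (induction i rule: less_induct)
    case (less i)
    then show ?case by (subst lower_inverse.simps) (auto intro!: sum.neutral)
  qed
  show ?thesis using * by (auto simp: lower_unitriangular_def)
qed

lemma lower_unitriangular_lower_triangular:
  "lower_unitriangular A \<Longrightarrow> lower_triangular A"
  by (simp add: lower_unitriangular_def lower_triangular_def)

lemma mult_lower_inverse:
  assumes "lower_unitriangular S"
  shows "S \<odot> lower_inverse S = smat_one"
proof (intro ext)
  fix i j
  have "(S \<odot> lower_inverse S) i j = (\<Sum>k\<le>i. S i k * lower_inverse S k j)"
    using assms by (simp add: lower_triangular_mult lower_unitriangular_lower_triangular)
  also have "\<dots> = (\<Sum>k<i. S i k * lower_inverse S k j) + lower_inverse S i j"
    using assms by (simp add: lessThan_Suc_atMost [symmetric] lower_unitriangular_def)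
  also have "\<dots> = smat_one i j"
    by (subst (2) lower_inverse.simps) (simp add: smat_one_def)
  finally show "(S \<odot> lower_inverse S) i j = smat_one i j" .
qed

text \<open>A right inverse that has a right inverse \<open>?C\<close> of its own is two-sided,
  since associativity gives \<open>S = ?C\<close>.\<close>

lemma smat_is_inverse_lower_inverse:
  assumes "lower_unitriangular S"
  shows "smat_is_inverse S (lower_inverse S)"
proof -
  let ?B = "lower_inverse S"
  let ?C = "lower_inverse ?B"
  have rf: "row_finite S" "row_finite ?B"
    using assms lower_unitriangular_lower_inverse
    by (blast intro: lower_triangular_row_finite lower_unitriangular_lower_triangular)+
  have "S = S \<odot> (?B \<odot> ?C)"
    by (simp add: mult_lower_inverse lower_unitriangular_lower_inverse)
  also have "\<dots> = (S \<odot> ?B) \<odot> ?C"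
    using rf by (simp add: smat_mult_assoc)
  also have "\<dots> = ?C" by (simp add: mult_lower_inverse assms)
  finally have "?B \<odot> S = smat_one"
    using mult_lower_inverse [OF lower_unitriangular_lower_inverse] by metis
  then show ?thesis by (simp add: smat_is_inverse_def mult_lower_inverse assms)
qed

lemma smat_inv_eqI:
  assumes "smat_is_inverse A B" and "\<And>C. smat_is_inverse A C \<Longrightarrow> C = B"
  shows "smat_inv A = B"
  unfolding smat_inv_def using assms by (rule the_equality)

lemma smat_inv_lower:
  assumes "lower_unitriangular S"
  shows "smat_is_inverse S (smat_inv S)" and "lower_triangular (smat_inv S)"
proof -
  let ?B = "lower_inverse S"
  have rf: "row_finite S" "row_finite ?B"
    using assms lower_unitriangular_lower_inverse
    by (blast intro: lower_triangular_row_finite lower_unitriangular_lower_triangular)+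
  have inv: "smat_is_inverse S ?B" using assms by (rule smat_is_inverse_lower_inverse)
  have "smat_inv S = ?B"
  proof (rule smat_inv_eqI [OF inv])
    \<comment> \<open>The competitor may be a full matrix; reassociation only needs the row-finite
      factors \<open>?B\<close> and \<open>S\<close> on its left.\<close>
    fix C assume "smat_is_inverse S C"
    then have "?B = ?B \<odot> (S \<odot> C)" by (simp add: smat_is_inverse_def)
    also have "\<dots> = (?B \<odot> S) \<odot> C" using rf by (simp add: smat_mult_assoc)
    also have "\<dots> = C" using inv by (simp add: smat_is_inverse_def)
    finally show "C = ?B" by simp
  qed
  then show "smat_is_inverse S (smat_inv S)" "lower_triangular (smat_inv S)"
    using inv lower_unitriangular_lower_inverse lower_unitriangular_lower_triangular by auto
qed

text \<open>An inverse of an upper triangular matrix could a priori be a full matrix, with genuine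
  series in the products. The left inverse relation involves only finite sums and forces it
  to be upper triangular, column by column.\<close>

lemma left_inverse_upper_triangular:
  assumes A: "upper_triangular A" and BA: "B \<odot> A = smat_one"
  shows "upper_triangular B"
proof -
  have sum: "(\<Sum>k\<le>j. B i k * A k j) = smat_one i j" for i j
  proof -
    have "(B \<odot> A) i j = (\<Sum>k\<le>j. B i k * A k j)"
      unfolding smat_mult_def
      by (rule suminf_mult_eq_sum) (use A in \<open>auto simp: upper_triangular_def not_less [symmetric]\<close>)
    with BA show ?thesis by simp
  qed
  have "\<forall>i>j. B i j = 0" for j
  proof (induction j rule: less_induct)
    case (less j)
    \<comment> \<open>The induction hypothesis removes all terms left of column \<open>j\<close>.
      The case \<open>i = j\<close> then gives a nonzero diagonal entry of \<open>A\<close>, and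
      \<open>i > j\<close> a zero entry of \<open>B\<close>.\<close>
    have red: "B i j * A j j = smat_one i j" if "j \<le> i" for i
    proof -
      have "(\<Sum>k\<le>j. B i k * A k j) = (\<Sum>k<j. B i k * A k j) + B i j * A j j"
        by (simp add: lessThan_Suc_atMost [symmetric])
      moreover have "(\<Sum>k<j. B i k * A k j) = 0"
        using less that by (intro sum.neutral) auto
      ultimately show ?thesis using sum [of i j] by simp
    qed
    have "A j j \<noteq> 0" using red [of j] by (auto simp: smat_one_def)
    moreover have "B i j * A j j = 0" if "j < i" for i
      using red [of i] that by (simp add: smat_one_def)
    ultimately show ?case by auto
  qed
  then show ?thesis by (auto simp: upper_triangular_def)
qed

lemma upper_triangular_transpose:
  "upper_triangular A \<longleftrightarrow> lower_triangular (smat_transpose A)"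
  by (auto simp: upper_triangular_def lower_triangular_def smat_transpose_def)

lemma smat_inv_upper:
  assumes A: "upper_triangular A" and inv: "smat_invertible A"
  shows "smat_is_inverse A (smat_inv A)" and "upper_triangular (smat_inv A)"
proof -
  obtain B where B: "smat_is_inverse A B" using inv by (auto simp: smat_invertible_def)
  have up: "upper_triangular C" if "smat_is_inverse A C" for C
    using left_inverse_upper_triangular [OF A] that by (auto simp: smat_is_inverse_def)
  have "smat_inv A = B"
  proof (rule smat_inv_eqI [OF B])
    fix C assume C: "smat_is_inverse A C"
    \<comment> \<open>Transposing makes the matrices on the left lower triangular, hence row-finite,
      so the usual uniqueness argument can be reassociated.\<close>
    let ?A = "smat_transpose A" and ?B = "smat_transpose B" and ?C = "smat_transpose C"
    have rf: "row_finite ?A" "row_finite ?B"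
      using A up [OF B] by (auto simp: upper_triangular_transpose intro: lower_triangular_row_finite)
    have "?B \<odot> ?A = smat_one" "?A \<odot> ?C = smat_one"
      using B C by (simp_all add: smat_is_inverse_def smat_transpose_mult [symmetric])
    then have "?C = ?B"
      by (metis rf smat_mult_assoc smat_one_mult smat_mult_one)
    then show "C = B" by (metis smat_transpose_transpose)
  qed
  then show "smat_is_inverse A (smat_inv A)" "upper_triangular (smat_inv A)"
    using B up by auto
qed

section \<open>Index bookkeeping\<close>

locale index_system =
  fixes p :: nat and n :: "nat \<Rightarrow> nat"
  assumes p_ge_1: "1 \<le> p" and comp: "composition p n"
begin

definition offset :: "nat \<Rightarrow> nat" where
  "offset a = (\<Sum>i = 1..<a. n i)"

text \<open>Cut the indices into consecutive segments of lengths
  \<open>n 1, ..., n p, n 1, ...\<close> and number them from 0; this is the number of the segment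
  containing \<open>l\<close>. Segments, unlike maximal runs of one type, advance cyclically also
  for \<open>p = 1\<close>.\<close>

definition block :: "nat \<Rightarrow> nat" where
  "block l = ind_k p n l * p + (ind_a p n l - 1)"

section \<open>Existence and uniqueness of the index decomposition\<close>

lemma offset_Suc: "1 \<le> a \<Longrightarrow> offset (Suc a) = offset a + n a"
  by (simp add: offset_def)

lemma offset_mono: "a \<le> b \<Longrightarrow> offset a \<le> offset b"
  unfolding offset_def by (rule sum_mono2) auto

lemma isize_eq_offset: "isize p n = offset (Suc p)"
  by (simp add: isize_def offset_def atLeastLessThanSuc_atLeastAtMost)

lemma n_pos: "a \<in> {1..p} \<Longrightarrow> 0 < n a"
  using comp by (auto simp: composition_def)

lemma offset_less_isize:
  assumes "a \<in> {1..p}" and "\<rho> < n a"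
  shows "offset a + \<rho> < isize p n"
proof -
  have "offset (Suc a) \<le> isize p n"
    unfolding isize_eq_offset by (rule offset_mono) (use assms in auto)
  then show ?thesis using assms by (simp add: offset_Suc)
qed

lemma decomp_unique:
  assumes "a \<in> {1..p}" "\<rho> < n a" "a' \<in> {1..p}" "\<rho>' < n a'"
    and eq: "k * isize p n + offset a + \<rho> = k' * isize p n + offset a' + \<rho>'"
  shows "k = k' \<and> a = a' \<and> \<rho> = \<rho>'"
proof -
  have lt: "offset a + \<rho> < isize p n" "offset a' + \<rho>' < isize p n"
    using offset_less_isize assms by auto
  have eq': "k * isize p n + (offset a + \<rho>) = k' * isize p n + (offset a' + \<rho>')"
    using eq by simp
  have "k = (k * isize p n + (offset a + \<rho>)) div isize p n" using lt by simp
  also have "\<dots> = k'" unfolding eq' using lt by simp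
  finally have k: "k = k'" .
  with eq have r: "offset a + \<rho> = offset a' + \<rho>'" by simp
  \<comment> \<open>A later type starts at \<open>offset b + n b\<close> or beyond, hence past
    \<open>offset b + s\<close>.\<close>
  have "\<not> b < c" if "b \<in> {1..p}" "s < n b" "offset b + s = offset c + t" for b c s t
    using offset_mono [of "Suc b" c] that by (auto simp: offset_Suc)
  then have "a = a'" using r assms by (metis linorder_neqE_nat)
  with k r show ?thesis by simp
qed

lemma decomp_exists:
  "\<exists>k a \<rho>. a \<in> {1..p} \<and> \<rho> < n a \<and> l = k * isize p n + offset a + \<rho>"
proof (induction l)
  case 0
  have "0 = 0 * isize p n + offset 1 + 0" by (simp add: offset_def)
  then show ?case using p_ge_1 n_pos [of 1] by (metis atLeastAtMost_iff order_refl)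
next
  case (Suc l)
  then obtain k a \<rho> where d: "a \<in> {1..p}" "\<rho> < n a" "l = k * isize p n + offset a + \<rho>" by blast
  \<comment> \<open>Adding one works like a counter with carry: the remainder grows, or it overflows
    into the next type, or after type \<open>p\<close> into the next period.\<close>
  consider "Suc \<rho> < n a" | "Suc \<rho> = n a" "a < p" | "Suc \<rho> = n a" "a = p"
    using d by fastforce
  then show ?case
  proof cases
    case 1
    then have "Suc l = k * isize p n + offset a + Suc \<rho>" using d by simp
    then show ?thesis using 1 d by blast
  next
    case 2
    then have "Suc l = k * isize p n + offset (Suc a) + 0" using d by (simp add: offset_Suc)
    moreover have "Suc a \<in> {1..p}" using 2 by simp
    ultimately show ?thesis using n_pos by blast
  next
    case 3
    then have "Suc l = Suc k * isize p n + offset 1 + 0"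
      using d by (simp add: isize_eq_offset offset_Suc offset_def)
    moreover have "1 \<in> {1..p}" using p_ge_1 by simp
    ultimately show ?thesis using n_pos by blast
  qed
qed

lemma index_decomp_eqI:
  assumes "a \<in> {1..p}" "\<rho> < n a" "l = k * isize p n + offset a + \<rho>"
  shows "index_decomp p n l = (k, a, \<rho>)"
  unfolding index_decomp_def offset_def [symmetric]
proof (rule the_equality)
  fix t
  assume t: "case t of (k, a, \<rho>) \<Rightarrow>
    a \<in> {1..p} \<and> \<rho> < n a \<and> l = k * isize p n + offset a + \<rho>"
  obtain k' a' \<rho>' where "t = (k', a', \<rho>')" by (cases t)
  with t decomp_unique [OF assms(1,2), of a' \<rho>' k k'] assms(3) show "t = (k, a, \<rho>)" by auto
qed (use assms in simp)

lemma ind_eqI: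
  assumes "a \<in> {1..p}" "\<rho> < n a" "l = k * isize p n + offset a + \<rho>"
  shows "ind_k p n l = k" "ind_a p n l = a" "ind_\<rho> p n l = \<rho>"
  using index_decomp_eqI [OF assms] by (simp_all add: ind_k_def ind_a_def ind_\<rho>_def)

lemma ind_decomp:
  shows "ind_a p n l \<in> {1..p}" "ind_\<rho> p n l < n (ind_a p n l)"
    "l = ind_k p n l * isize p n + offset (ind_a p n l) + ind_\<rho> p n l"
  using decomp_exists [of l] ind_eqI [where l = l] by auto

text \<open>Indices of type \<open>a\<close> are parametrized by the exponent of \<open>x\<close> in the
  corresponding entry of \<open>xi\<close>.\<close>

definition idx :: "nat \<Rightarrow> nat \<Rightarrow> nat" where
  "idx a e = e div n a * isize p n + offset a + e mod n a"

definition expo :: "nat \<Rightarrow> nat" where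
  "expo l = ind_k p n l * n (ind_a p n l) + ind_\<rho> p n l"

section \<open>Enumeration of the indices of one type\<close>

lemma idx_expo: "idx (ind_a p n l) (expo l) = l"
  using ind_decomp [of l] by (simp add: idx_def expo_def)

lemma ind_a_idx:
  assumes "a \<in> {1..p}" shows "ind_a p n (idx a e) = a"
  by (rule ind_eqI(2)) (use assms n_pos [OF assms] in \<open>auto simp: idx_def\<close>)

lemma expo_idx:
  assumes "a \<in> {1..p}" shows "expo (idx a e) = e"
proof -
  have "ind_k p n (idx a e) = e div n a" "ind_\<rho> p n (idx a e) = e mod n a"
    by (rule ind_eqI; use assms n_pos [OF assms] in \<open>auto simp: idx_def\<close>)+
  then show ?thesis using assms by (simp add: expo_def ind_a_idx)
qed

lemma strict_mono_idx:
  assumes "a \<in> {1..p}" shows "strict_mono (idx a)"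
proof (rule strict_monoI_Suc)
  fix e
  have pos: "0 < n a" using assms by (rule n_pos)
  \<comment> \<open>When \<open>Suc e\<close> is a multiple of \<open>n a\<close>, the remainder
    \<open>e mod n a\<close> is lost but a whole period is gained, which outweighs it.\<close>
  have "isize p n \<ge> n a" unfolding isize_def by (rule member_le_sum) (use assms in auto)
  moreover have "e mod n a < n a" using pos by simp
  ultimately have "e mod n a < isize p n" by linarith
  then show "idx a e < idx a (Suc e)"
    unfolding idx_def using pos by (auto simp: div_Suc mod_Suc)
qed

text \<open>Since \<open>idx a\<close> enumerates the indices of type \<open>a\<close> in increasing
  order, the next one has the next exponent.\<close>

lemma next_idx_Suc:
  "next_idx p n (l + 1) (ind_a p n l) = idx (ind_a p n l) (Suc (expo l))"
proof -
  let ?a = "ind_a p n l"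
  have a: "?a \<in> {1..p}" by (rule ind_decomp)
  have sm: "strict_mono (idx ?a)" by (rule strict_mono_idx [OF a])
  show ?thesis
    unfolding next_idx_def
  proof (rule Least_equality, intro conjI)
    show "l + 1 \<le> idx ?a (Suc (expo l))"
      using strict_monoD [OF sm, of "expo l" "Suc (expo l)"] by (simp add: idx_expo)
    show "ind_a p n (idx ?a (Suc (expo l))) = ?a" by (rule ind_a_idx [OF a])
  next
    fix m assume m: "l + 1 \<le> m \<and> ind_a p n m = ?a"
    then have "idx ?a (expo l) < idx ?a (expo m)" using idx_expo [of l] idx_expo [of m] by simp
    then have "Suc (expo l) \<le> expo m" using sm by (simp add: strict_mono_less Suc_le_eq)
    then have "idx ?a (Suc (expo l)) \<le> idx ?a (expo m)" using sm by (simp add: strict_mono_less_eq)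
    then show "idx ?a (Suc (expo l)) \<le> m" using idx_expo [of m] m by simp
  qed
qed

text \<open>Entrywise form of the relation \<open>\<Upsilon> \<xi> = x \<xi>\<close>: one step
  within a type raises the exponent by one.\<close>

lemma xi_next_idx: "xi p w n x (next_idx p n (l + 1) (ind_a p n l)) = x * xi p w n x l"
proof -
  have eq: "xi p w n x m = w (ind_a p n m) x * x ^ expo m" for m by (simp add: xi_def expo_def)
  show ?thesis
    unfolding eq next_idx_Suc using ind_decomp(1) [of l] by (simp add: ind_a_idx expo_idx)
qed

lemma next_idx_props:
  assumes "a \<in> {1..p}"
  shows "l \<le> next_idx p n l a" "ind_a p n (next_idx p n l a) = a"
proof -
  have "l \<le> idx a l" using strict_mono_idx [OF assms] by (rule strict_mono_imp_increasing)
  then have "l \<le> idx a l \<and> ind_a p n (idx a l) = a" using assms by (simp add: ind_a_idx)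
  from LeastI [of "\<lambda>m. l \<le> m \<and> ind_a p n m = a", OF this]
  show "l \<le> next_idx p n l a" "ind_a p n (next_idx p n l a) = a"
    by (auto simp: next_idx_def)
qed

lemma next_idx_le: "l \<le> m \<Longrightarrow> next_idx p n l (ind_a p n m) \<le> m"
  unfolding next_idx_def by (rule Least_le) simp

text \<open>The bound on \<open>l\<close> puts the whole first period into \<open>{0..l}\<close>, so
  \<open>offset a\<close> is a candidate for the greatest index, which is unspecified without
  candidates.\<close>

lemma prev_idx_props:
  assumes a: "a \<in> {1..p}" and l: "isize p n \<le> Suc l"
  shows "prev_idx p n l a \<le> l" "ind_a p n (prev_idx p n l a) = a"
proof -
  have "offset a < isize p n" using offset_less_isize [OF a n_pos [OF a]] by simp
  then have "offset a \<le> l" using l by simp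
  moreover have "ind_a p n (offset a) = a"
    by (rule ind_eqI(2) [of _ 0 _ 0]) (use a n_pos in auto)
  ultimately have "offset a \<le> l \<and> ind_a p n (offset a) = a" by simp
  from GreatestI_nat [of "\<lambda>m. m \<le> l \<and> ind_a p n m = a", OF this]
  show "prev_idx p n l a \<le> l" "ind_a p n (prev_idx p n l a) = a"
    by (auto simp: prev_idx_def)
qed

section \<open>Cyclic succession of blocks and the bounds of the index rectangles\<close>

lemma block_Suc: "block (Suc l) = block l \<or> block (Suc l) = Suc (block l)"
proof -
  let ?k = "ind_k p n l" and ?a = "ind_a p n l" and ?\<rho> = "ind_\<rho> p n l"
  note d = ind_decomp [of l]
  consider "Suc ?\<rho> < n ?a" | "Suc ?\<rho> = n ?a" "?a < p" | "Suc ?\<rho> = n ?a" "?a = p"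
    using d by fastforce
  then show ?thesis
  proof cases
    case 1
    then have "Suc l = ?k * isize p n + offset ?a + Suc ?\<rho>" using d by simp
    from ind_eqI [OF d(1) 1 this] show ?thesis by (simp add: block_def)
  next
    case 2
    then have "Suc l = ?k * isize p n + offset (Suc ?a) + 0" using d by (simp add: offset_Suc)
    from ind_eqI [OF _ _ this] 2 n_pos [of "Suc ?a"] show ?thesis
      using d(1) by (simp add: block_def)
  next
    case 3
    then have "Suc l = Suc ?k * isize p n + offset 1 + 0"
      using d by (simp add: isize_eq_offset offset_Suc offset_def)
    from ind_eqI [OF _ _ this] 3 n_pos [of 1] show ?thesis
      using p_ge_1 by (simp add: block_def)
  qed
qed

lemma block_mono: "l \<le> m \<Longrightarrow> block l \<le> block m"
  by (rule lift_Suc_mono_le [of block]) (metis block_Suc le_SucI order_refl)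

text \<open>Discrete intermediate value property: by \<open>block_Suc\<close> no block number is
  skipped.\<close>

lemma block_intermediate:
  assumes "l \<le> m" "block l \<le> b" "b \<le> block m"
  obtains i where "l \<le> i" "i \<le> m" "block i = b"
  using assms
proof (induction m arbitrary: thesis rule: dec_induct)
  case base
  then show ?case by (metis order_antisym order_refl)
next
  case (step m)
  show ?case
  proof (cases "b \<le> block m")
    case True
    with step show ?thesis by (metis le_SucI)
  next
    case False
    with block_Suc [of m] step have "block (Suc m) = b" by auto
    with step show ?thesis by (metis le_SucI order_refl)
  qed
qed

lemma cyc_props: "cyc p m \<in> {1..p}" "[int (cyc p m) = m] (mod int p)"
proof -
  \<comment> \<open>Shifting by one before and after the reduction picks the representative in
    \<open>{1..p}\<close> instead of \<open>{0..p-1}\<close>.\<close>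
  define c where "c = nat ((m - 1) mod int p + 1)"
  have p: "0 < int p" using p_ge_1 by simp
  have ic: "int c = (m - 1) mod int p + 1" using p by (simp add: c_def)
  have lt: "(m - 1) mod int p < int p" "0 \<le> (m - 1) mod int p" using p by auto
  then have "1 \<le> int c" "int c \<le> int p" using ic by linarith+
  then have c: "c \<in> {1..p}" by simp
  have "[(m - 1) mod int p + 1 = (m - 1) + 1] (mod int p)"
    by (rule cong_add) (simp_all add: cong_def)
  then have cm: "[int c = m] (mod int p)" using ic by simp
  have "cyc p m = c"
    unfolding cyc_def
  proof (rule the_equality)
    show "c \<in> {1..p} \<and> [int c = m] (mod int p)" using c cm by simp
    fix i assume i: "i \<in> {1..p} \<and> [int i = m] (mod int p)"
    then have "[int i = int c] (mod int p)" using cm by (meson cong_sym cong_trans)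
    then have "[int i - 1 = int c - 1] (mod int p)" by (intro cong_diff) auto
    then have "int i - 1 = int c - 1" using i c by (auto simp: cong_def)
    then show "i = c" by simp
  qed
  then show "cyc p m \<in> {1..p}" "[int (cyc p m) = m] (mod int p)" using c cm by auto
qed

text \<open>Types are numbered from 1 and blocks from 0, hence the added 1.\<close>

lemma block_cong: "[int (block l) + 1 = int (ind_a p n l)] (mod int p)"
proof -
  have "int (block l) + 1 = int (ind_a p n l) + int (ind_k p n l) * int p"
    using ind_decomp(1) [of l] by (simp add: block_def of_nat_diff)
  then show ?thesis by (simp add: cong_def)
qed

text \<open>A run of \<open>p\<close> consecutive blocks contains every type.\<close>

lemma type_between:
  assumes "l \<le> m" and "block l + p \<le> Suc (block m)" and a: "a \<in> {1..p}"
  obtains i where "l \<le> i" "i \<le> m" "ind_a p n i = a"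
proof -
  \<comment> \<open>The first block number from \<open>block l\<close> on that belongs to type
    \<open>a\<close>; it is less than \<open>block l + p\<close>.\<close>
  define b where "b = block l + nat ((int a - 1 - int (block l)) mod int p)"
  have p: "0 < int p" using p_ge_1 by simp
  have ib: "int b = int (block l) + (int a - 1 - int (block l)) mod int p"
    using p by (simp add: b_def)
  have "(int a - 1 - int (block l)) mod int p < int p" "0 \<le> (int a - 1 - int (block l)) mod int p"
    using p by auto
  then have "block l \<le> b" "b \<le> block m" using ib assms(2) by linarith+
  then obtain i where i: "l \<le> i" "i \<le> m" "block i = b"
    using block_intermediate assms(1) by blast
  have "[int (block i) + 1 = int a] (mod int p)"
    using mod_add_left_eq [of "int a - 1 - int (block l)" "int p" "int (block l) + 1"]
    unfolding i(3) ib cong_def by (simp add: ac_simps)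
  then have "[int (ind_a p n i) = int a] (mod int p)"
    using block_cong [of i] by (meson cong_sym cong_trans)
  then have "[int (ind_a p n i) - 1 = int a - 1] (mod int p)" by (intro cong_diff) auto
  then have "ind_a p n i = a"
    using ind_decomp(1) [of i] a by (auto simp: cong_def)
  with i show thesis using that by blast
qed

text \<open>The number \<open>c + 1 - b\<close> is a positive multiple of \<open>p\<close>. So if
  block \<open>c\<close> has the type cyclically before that of block \<open>b\<close>, the blocks
  from \<open>b\<close> to \<open>c\<close> make up full periods.\<close>

lemma block_gap:
  assumes "b \<le> c" and "[int c + 1 = int b] (mod int p)"
  shows "b + p \<le> Suc c"
proof -
  have "int p dvd int c + 1 - int b" using assms(2) by (simp add: cong_iff_dvd_diff)
  moreover have "int c + 1 - int b > 0" using assms(1) by simp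
  ultimately have "int p \<le> int c + 1 - int b" by (simp add: zdvd_imp_le)
  then show ?thesis by simp
qed

text \<open>Let \<open>r\<close> be the bound on the right. Its type cyclically precedes that of
  \<open>l\<close>, so the indices from \<open>l\<close> to \<open>r\<close> meet every type. The
  type of \<open>m\<close> is met there, and its first visit after \<open>m\<close> comes no
  later.\<close>

lemma next_idx_upper:
  assumes "m < l" and "l \<le> next_idx p n (m + 1) (ind_a p n m)"
  shows "next_idx p n (m + 1) (ind_a p n m) \<le> next_idx p n l (cyc p (int (ind_a p n l) - 1))"
proof -
  define r where "r = next_idx p n l (cyc p (int (ind_a p n l) - 1))"
  have r: "l \<le> r" "ind_a p n r = cyc p (int (ind_a p n l) - 1)"
    unfolding r_def by (intro next_idx_props cyc_props)+
  have "[int (block r) + 1 = int (ind_a p n l) - 1] (mod int p)"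
    using block_cong [of r] cyc_props(2) unfolding r(2) by (rule cong_trans)
  moreover have "[int (ind_a p n l) - 1 = int (block l) + 1 - 1] (mod int p)"
    using block_cong [of l] by (intro cong_diff cong_refl) (rule cong_sym)
  ultimately have "[int (block r) + 1 = int (block l)] (mod int p)"
    using cong_trans by fastforce
  then have "block l + p \<le> Suc (block r)" by (rule block_gap [OF block_mono [OF r(1)]])
  then obtain i where "l \<le> i" "i \<le> r" "ind_a p n i = ind_a p n m"
    using type_between [OF r(1)] ind_decomp(1) by metis
  moreover then have "next_idx p n (m + 1) (ind_a p n m) \<le> i"
    using next_idx_le [of "m + 1" i] assms(1) by simp
  ultimately show ?thesis by (simp add: r_def)
qed

text \<open>Mirror image: the indices from the bound on the left up to \<open>l - 1\<close> meet
  every type. If \<open>m\<close> were below that bound, its type would recur before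
  \<open>l\<close>, contrary to the second assumption.\<close>

lemma prev_idx_lower:
  assumes "m < l" and "l \<le> next_idx p n (m + 1) (ind_a p n m)" and "isize p n \<le> l"
  shows "prev_idx p n (l - 1) (cyc p (int (ind_a p n (l - 1)) + 1)) \<le> m"
proof (rule ccontr)
  define h where "h = l - 1"
  define r where "r = prev_idx p n h (cyc p (int (ind_a p n h) + 1))"
  assume "\<not> ?thesis"
  then have "m < r" by (simp add: r_def h_def)
  have r: "r \<le> h" "ind_a p n r = cyc p (int (ind_a p n h) + 1)"
    unfolding r_def by (intro prev_idx_props cyc_props; use assms in \<open>simp add: h_def\<close>)+
  have "[int (block h) + 1 + 1 = int (ind_a p n h) + 1] (mod int p)"
    using block_cong [of h] by (intro cong_add cong_refl)
  moreover have "[int (ind_a p n h) + 1 = int (block r) + 1] (mod int p)"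
    using block_cong [of r] cyc_props(2) unfolding r(2) by (meson cong_sym cong_trans)
  ultimately have "[int (block h) + 1 + 1 = int (block r) + 1] (mod int p)" by (rule cong_trans)
  then have "[int (block h) + 1 = int (block r)] (mod int p)"
    by (simp add: cong_iff_dvd_diff algebra_simps)
  then have "block r + p \<le> Suc (block h)" by (rule block_gap [OF block_mono [OF r(1)]])
  then obtain i where "r \<le> i" "i \<le> h" "ind_a p n i = ind_a p n m"
    using type_between [OF r(1)] ind_decomp(1) by metis
  moreover then have "next_idx p n (m + 1) (ind_a p n m) \<le> i"
    using next_idx_le [of "m + 1" i] \<open>m < r\<close> by simp
  ultimately show False using assms by (simp add: h_def)
qed

section \<open>The shift matrix and its conjugates\<close>

lemma row_finite_shift: "row_finite (shift_matrix p n)"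
  by (simp add: row_finite_def shift_matrix_def)

lemma shift_mult:
  "(shift_matrix p n \<odot> B) i j = B (next_idx p n (i + 1) (ind_a p n i)) j"
proof -
  let ?m = "next_idx p n (i + 1) (ind_a p n i)"
  have "(shift_matrix p n \<odot> B) i j = (\<Sum>k\<in>{?m}. shift_matrix p n i k * B k j)"
    unfolding smat_mult_def
    by (rule suminf_mult_eq_sum) (auto simp: shift_matrix_def split: if_splits)
  then show ?thesis by (simp add: shift_matrix_def)
qed

text \<open>\<open>B\<close> cancels the inner \<open>A\<close>, and the shift multiplies
  \<open>xi\<close> by \<open>x\<close>. This serves \<open>J\<close> with \<open>A = S\<close>, and
  its transpose with \<open>A\<close> the transposed inverse of \<open>Sb\<close>.\<close>

lemma conj_shift_eigen:
  assumes "lower_triangular A" "lower_triangular B" "B \<odot> A = smat_one"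
  shows "smat_vec (A \<odot> shift_matrix p n \<odot> B) (smat_vec A (xi p w n x)) i
    = x * smat_vec A (xi p w n x) i"
proof -
  let ?U = "shift_matrix p n" and ?\<xi> = "xi p w n x"
  note rf = assms(1,2) [THEN lower_triangular_row_finite] row_finite_shift
  have U: "smat_vec ?U ?\<xi> = (\<lambda>k. x * ?\<xi> k)"
    by (auto simp: smat_vec_eq_mult [of _ _ _ 0] shift_mult xi_next_idx simp del: One_nat_def)
  have "A \<odot> ?U \<odot> B \<odot> A = A \<odot> ?U"
    using rf assms(3) by (simp add: smat_mult_assoc row_finite_mult)
  moreover have "smat_vec (A \<odot> ?U \<odot> B \<odot> A) ?\<xi> = smat_vec (A \<odot> ?U \<odot> B) (smat_vec A ?\<xi>)"
    using rf by (simp add: smat_vec_mult row_finite_mult)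
  moreover have "smat_vec (A \<odot> ?U) ?\<xi> = smat_vec A (\<lambda>k. x * ?\<xi> k)"
    using rf by (simp add: smat_vec_mult U)
  ultimately have "smat_vec (A \<odot> ?U \<odot> B) (smat_vec A ?\<xi>) = smat_vec A (\<lambda>k. x * ?\<xi> k)"
    by simp
  then show ?thesis using rf by (simp add: smat_vec_scale)
qed

text \<open>By triangularity a nonzero entry comes from some \<open>m \<le> j\<close> whose
  successor \<open>r\<close> of the same type satisfies \<open>i \<le> r\<close>. The jump from
  \<open>m\<close> to \<open>r\<close> crosses the cut at \<open>l\<close>, so the two preceding
  bounds confine \<open>m\<close> from below and \<open>r\<close> from above, hence also
  \<open>j\<close> and \<open>i\<close>.\<close>

lemma conj_shift_band:
  assumes "lower_triangular A" "lower_triangular B"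
    and nz: "(A \<odot> shift_matrix p n \<odot> B) j i \<noteq> 0"
    and "j < l" "l \<le> i" "isize p n \<le> l"
  shows "(i, j) \<in> sigma1 p n l"
proof -
  note rf = assms(1,2) [THEN lower_triangular_row_finite] row_finite_shift
  obtain r where r: "(A \<odot> shift_matrix p n) j r \<noteq> 0" "B r i \<noteq> 0"
    using mult_nonzeroE [OF row_finite_mult [OF rf(1,3)] nz] by blast
  then obtain m where m: "A j m \<noteq> 0" "shift_matrix p n m r \<noteq> 0"
    using mult_nonzeroE [OF rf(1)] by blast
  have "m \<le> j" "i \<le> r" using m r assms(1,2) by (auto simp: lower_triangular_def not_less [symmetric])
  have req: "r = next_idx p n (m + 1) (ind_a p n m)"
    using m by (simp add: shift_matrix_def split: if_splits)
  have "m < l" and le: "l \<le> next_idx p n (m + 1) (ind_a p n m)"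
    using \<open>m \<le> j\<close> \<open>i \<le> r\<close> assms req by auto
  from next_idx_upper [OF this] prev_idx_lower [OF this assms(6)] show ?thesis
    unfolding sigma1_def using req \<open>m \<le> j\<close> \<open>i \<le> r\<close> assms by auto
qed

end

text \<open>Swapping the coordinates lets \<open>conj_shift_band\<close> cover the transpose of
  \<open>J\<close> too.\<close>

lemma sigma2_eq_converse: "sigma2 p n l = prod.swap ` sigma1 p n l"
  by (auto simp: sigma1_def sigma2_def image_iff)

text \<open>For \<open>l = 0\<close> the truncated \<open>l - 1\<close> would be 0 and not below the
  cut.\<close>

lemma sigma1_cutD: "0 < l \<Longrightarrow> (i, j) \<in> sigma1 p n l \<Longrightarrow> j < l \<and> l \<le> i"
  by (auto simp: sigma1_def)

lemma finite_sigma1: "finite (sigma1 p n l)"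
  by (simp add: sigma1_def)

section \<open>The moment matrix and the Christoffel--Darboux formula\<close>

text \<open>Either shift brings one factor \<open>x\<close> into the integrand.\<close>

lemma shift_moment_matrix:
  fixes \<Delta> :: "real set" and \<mu> :: "real measure" and w1 w2 :: "nat \<Rightarrow> real \<Rightarrow> real"
  assumes "index_system p1 n1" "index_system p2 n2"
  defines "g \<equiv> moment_matrix \<Delta> \<mu> p1 w1 n1 p2 w2 n2"
  shows "shift_matrix p1 n1 \<odot> g = g \<odot> smat_transpose (shift_matrix p2 n2)"
proof (intro ext)
  fix i j
  interpret I1: index_system p1 n1 by fact
  interpret I2: index_system p2 n2 by fact
  have "(shift_matrix p1 n1 \<odot> g) i j
      = (LINT x:\<Delta>|\<mu>. xi p1 w1 n1 x i * (x * xi p2 w2 n2 x j))"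
    unfolding I1.shift_mult g_def moment_matrix_def I1.xi_next_idx by (simp add: mult_ac)
  also have "\<dots> = (shift_matrix p2 n2 \<odot> smat_transpose g) j i"
    unfolding I2.shift_mult g_def moment_matrix_def smat_transpose_def I2.xi_next_idx ..
  also have "\<dots> = (g \<odot> smat_transpose (shift_matrix p2 n2)) i j"
    by (simp add: smat_transpose_def smat_mult_def mult.commute)
  finally show "(shift_matrix p1 n1 \<odot> g) i j = (g \<odot> smat_transpose (shift_matrix p2 n2)) i j" .
qed

text \<open>Writing \<open>U1\<close>, \<open>U2\<close> for the shifts,
  \<open>J Sb = S U1 g = S g U2^T = Sb U2^T\<close>, and \<open>Sb\<close> is cancelled on the
  right. In the transposed form the outer factors are lower triangular, as
  \<open>conj_shift_eigen\<close> and \<open>conj_shift_band\<close> require.\<close>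

lemma jacobi_transpose:
  assumes "lower_unitriangular S" "upper_triangular Sb" "smat_invertible Sb"
    and g: "g = smat_inv S \<odot> Sb"
    and shift: "shift_matrix p1 n1 \<odot> g = g \<odot> smat_transpose (shift_matrix p2 n2)"
    and rfU: "row_finite (shift_matrix p1 n1)" "row_finite (shift_matrix p2 n2)"
  shows "smat_transpose (jacobi p1 n1 S)
    = smat_transpose (smat_inv Sb) \<odot> shift_matrix p2 n2 \<odot> smat_transpose Sb"
proof -
  let ?U1 = "shift_matrix p1 n1" and ?U2 = "shift_matrix p2 n2"
  let ?J = "jacobi p1 n1 S" and ?B = "smat_inv Sb"
  have S: "row_finite S" "row_finite (smat_inv S)" "S \<odot> smat_inv S = smat_one"
    using assms(1) smat_inv_lower [OF assms(1)]
    by (auto simp: smat_is_inverse_def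
        intro: lower_triangular_row_finite lower_unitriangular_lower_triangular)
  have Sb: "row_finite (smat_transpose Sb)" "row_finite (smat_transpose ?B)" "Sb \<odot> ?B = smat_one"
    using assms(2) smat_inv_upper [OF assms(2,3)]
    by (auto simp: smat_is_inverse_def upper_triangular_transpose intro: lower_triangular_row_finite)
  have rfJ: "row_finite ?J"
    unfolding jacobi_def by (intro row_finite_mult S rfU)
  have "?J \<odot> Sb = S \<odot> (?U1 \<odot> g)"
    unfolding jacobi_def g using S rfU by (simp add: smat_mult_assoc row_finite_mult)
  also have "\<dots> = (S \<odot> g) \<odot> smat_transpose ?U2"
    unfolding shift using S rfU by (simp add: smat_mult_assoc)
  also have "S \<odot> g = Sb"
    unfolding g using S by (simp add: smat_mult_assoc [symmetric])
  finally have JSb: "?J \<odot> Sb = Sb \<odot> smat_transpose ?U2" .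
  have "?J = ?J \<odot> (Sb \<odot> ?B)" using Sb by simp
  also have "\<dots> = (?J \<odot> Sb) \<odot> ?B" using rfJ Sb by (simp add: smat_mult_assoc)
  finally have "smat_transpose ?J = smat_transpose ((Sb \<odot> smat_transpose ?U2) \<odot> ?B)"
    using JSb by simp
  also have "\<dots> = smat_transpose ?B \<odot> ?U2 \<odot> smat_transpose Sb"
    using Sb rfU by (simp add: smat_transpose_mult smat_mult_assoc)
  finally show ?thesis .
qed

text \<open>\<open>A\<close> and \<open>B\<close> only have to contain the nonzero entries across
  the cut; zero entries inside them do no harm, so the rectangles can be inserted without knowing
  the exact support of \<open>J\<close>.\<close>

lemma CD_band:
  fixes J :: smat and q qb :: "nat \<Rightarrow> real"
  assumes l: "0 < l"
    and eig1: "\<And>k. smat_vec J q k = y * q k"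
    and eig2: "\<And>k. smat_vec (smat_transpose J) qb k = x * qb k"
    and band1: "\<And>i j. j < l \<Longrightarrow> l \<le> i \<Longrightarrow> J j i \<noteq> 0 \<Longrightarrow> (i, j) \<in> A"
    and band2: "\<And>i j. i < l \<Longrightarrow> l \<le> j \<Longrightarrow> J j i \<noteq> 0 \<Longrightarrow> (i, j) \<in> B"
    and A: "finite A" "\<And>i j. (i, j) \<in> A \<Longrightarrow> j < l \<and> l \<le> i"
    and B: "finite B" "\<And>i j. (i, j) \<in> B \<Longrightarrow> i < l \<and> l \<le> j"
  shows "(y - x) * (\<Sum>k<l. q k * qb k)
    = (\<Sum>(i, j)\<in>A. qb j * J j i * q i) - (\<Sum>(i, j)\<in>B. qb j * J j i * q i)"
proof -
  let ?t = "\<lambda>i j. qb j * J j i * q i"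
  \<comment> \<open>A cutoff beyond \<open>l\<close> and all coordinates in \<open>A\<close> and
    \<open>B\<close> that lie past the cut: rows and columns of \<open>J\<close> with number below
    \<open>l\<close> vanish from \<open>M\<close> on, and their series become finite sums.\<close>
  define M where "M = Max (insert l (fst ` A \<union> snd ` B)) + 1"
  have fin: "finite (insert l (fst ` A \<union> snd ` B))" using A B by simp
  have MA: "i < M" if "(i, j) \<in> A" for i j
    unfolding M_def using Max_ge [OF fin, of i] that by force
  have MB: "j < M" if "(i, j) \<in> B" for i j
    unfolding M_def using Max_ge [OF fin, of j] that by force
  have lM: "l \<le> M" unfolding M_def using Max_ge [OF fin, of l] by simp
  have split: "(\<Sum>i<M. f i) = (\<Sum>i<l. f i) + (\<Sum>i\<in>{l..<M}. f i)" for f :: "nat \<Rightarrow> real"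
    using sum.atLeastLessThan_concat [of 0 l M f] lM by (simp add: atLeast0LessThan)
  have supp1: "i < M" if "k < l" "J k i \<noteq> 0" for k i
    using MA [OF band1 [OF that(1) _ that(2)]] lM by linarith
  have supp2: "j < M" if "k < l" "J j k \<noteq> 0" for k j
    using MB [OF band2 [OF that(1) _ that(2)]] lM by linarith
  have zero1: "J j i = 0" if "j < l" "l \<le> i" "(i, j) \<notin> A" for i j
    using band1 that by blast
  have zero2: "J j i = 0" if "i < l" "l \<le> j" "(i, j) \<notin> B" for i j
    using band2 that by blast
  have row: "y * q k = (\<Sum>i<M. J k i * q i)" if "k < l" for k
    unfolding eig1 [symmetric] smat_vec_def
    by (rule suminf_mult_eq_sum) (use supp1 [OF that] in auto)
  have col: "x * qb k = (\<Sum>j<M. J j k * qb j)" if "k < l" for k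
    unfolding eig2 [symmetric] smat_vec_def smat_transpose_def
    by (rule suminf_mult_eq_sum) (use supp2 [OF that] in auto)
  have "y * (\<Sum>k<l. q k * qb k) = (\<Sum>k<l. (y * q k) * qb k)"
    by (simp add: sum_distrib_left mult_ac)
  also have "\<dots> = (\<Sum>k<l. \<Sum>i<M. ?t i k)"
    by (rule sum.cong) (auto simp: row sum_distrib_left sum_distrib_right mult_ac)
  also have "\<dots> = (\<Sum>k<l. \<Sum>i<l. ?t i k) + (\<Sum>k<l. \<Sum>i\<in>{l..<M}. ?t i k)"
    by (simp add: split sum.distrib)
  also have "(\<Sum>k<l. \<Sum>i\<in>{l..<M}. ?t i k) = (\<Sum>(i, j)\<in>{l..<M} \<times> {..<l}. ?t i j)"
    by (subst sum.swap) (simp add: sum.cartesian_product)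
  also have "\<dots> = (\<Sum>(i, j)\<in>A. ?t i j)"
    by (rule sum.mono_neutral_right) (auto simp: zero1 MA dest: A(2))
  finally have Y: "y * (\<Sum>k<l. q k * qb k) = (\<Sum>k<l. \<Sum>i<l. ?t i k) + (\<Sum>(i, j)\<in>A. ?t i j)" .
  have "x * (\<Sum>k<l. q k * qb k) = (\<Sum>k<l. (x * qb k) * q k)"
    by (simp add: sum_distrib_left mult_ac)
  also have "\<dots> = (\<Sum>k<l. \<Sum>j<M. ?t k j)"
    by (rule sum.cong) (auto simp: col sum_distrib_left sum_distrib_right mult_ac)
  also have "\<dots> = (\<Sum>k<l. \<Sum>j<l. ?t k j) + (\<Sum>k<l. \<Sum>j\<in>{l..<M}. ?t k j)"
    by (simp add: split sum.distrib)
  also have "(\<Sum>k<l. \<Sum>j\<in>{l..<M}. ?t k j) = (\<Sum>(i, j)\<in>{..<l} \<times> {l..<M}. ?t i j)"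
    by (simp add: sum.cartesian_product)
  also have "\<dots> = (\<Sum>(i, j)\<in>B. ?t i j)"
    by (rule sum.mono_neutral_right) (auto simp: zero2 MB dest: B(2))
  also have "(\<Sum>k<l. \<Sum>j<l. ?t k j) = (\<Sum>k<l. \<Sum>i<l. ?t i k)" by (rule sum.swap)
  finally have X: "x * (\<Sum>k<l. q k * qb k) = (\<Sum>k<l. \<Sum>i<l. ?t i k) + (\<Sum>(i, j)\<in>B. ?t i j)" .
  show ?thesis using X Y by (simp add: left_diff_distrib)
qed

theorem theorem1:
  fixes \<Delta> :: "real set" and \<mu> :: "real measure"
    and p1 p2 :: nat and w1 w2 :: "nat \<Rightarrow> real \<Rightarrow> real"
    and n1 n2 :: "nat \<Rightarrow> nat"
    and g S Sb J :: smat and Q Qb :: "nat \<Rightarrow> real \<Rightarrow> real"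
    and l :: nat and x y :: real
  assumes "admissible_measure \<Delta> \<mu>"
    and "p1 \<ge> 1" and "p2 \<ge> 1"
    and "admissible_weights \<Delta> \<mu> p1 w1" and "admissible_weights \<Delta> \<mu> p2 w2"
    and "finite_moments \<Delta> \<mu> p1 w1 p2 w2"
    and "perfect \<Delta> \<mu> p1 w1 p2 w2"
    and "composition p1 n1" and "composition p2 n2"
    and "g = moment_matrix \<Delta> \<mu> p1 w1 n1 p2 w2 n2"
    and "gauss_borel g S Sb"
    and "Q = lin_form p1 w1 n1 S"
    and "Qb = dual_form p2 w2 n2 Sb"
    and "J = jacobi p1 n1 S"
    and "l \<ge> max (isize p1 n1) (isize p2 n2)"
    and "x \<in> \<Delta>" and "y \<in> \<Delta>"
  shows "(y - x) * CD_kernel Q Qb l x y =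
      (\<Sum>(i, j)\<in>sigma1 p1 n1 l. Qb j x * J j i * Q i y)
    - (\<Sum>(i, j)\<in>sigma2 p2 n2 l. Qb j x * J j i * Q i y)"
proof -
  interpret I1: index_system p1 n1 by unfold_locales fact+
  interpret I2: index_system p2 n2 by unfold_locales fact+
  have S: "lower_unitriangular S" and Sb: "upper_triangular Sb" "smat_invertible Sb"
    and g: "g = smat_inv S \<odot> Sb"
    using assms(11) by (auto simp: gauss_borel_def)
  let ?B = "smat_transpose (smat_inv Sb)"
  have J: "J = S \<odot> shift_matrix p1 n1 \<odot> smat_inv S" using assms(14) by (simp add: jacobi_def)
  have JT: "smat_transpose J = ?B \<odot> shift_matrix p2 n2 \<odot> smat_transpose Sb"
    unfolding assms(14)
  proof (rule jacobi_transpose [OF S Sb g _ I1.row_finite_shift I2.row_finite_shift])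
    show "shift_matrix p1 n1 \<odot> g = g \<odot> smat_transpose (shift_matrix p2 n2)"
      unfolding assms(10)
      by (rule shift_moment_matrix) (rule I1.index_system_axioms I2.index_system_axioms)+
  qed
  have lt: "lower_triangular S" "lower_triangular (smat_inv S)" "smat_inv S \<odot> S = smat_one"
    using S smat_inv_lower [OF S] by (auto simp: smat_is_inverse_def lower_unitriangular_lower_triangular)
  have lt': "lower_triangular ?B" "lower_triangular (smat_transpose Sb)"
    "smat_transpose Sb \<odot> ?B = smat_one"
    using Sb smat_inv_upper [OF Sb]
    by (auto simp: smat_is_inverse_def upper_triangular_transpose smat_transpose_mult [symmetric])
  have size: "isize p1 n1 \<le> l" "isize p2 n2 \<le> l" using assms(15) by auto
  have "0 < isize p1 n1" using I1.offset_less_isize [of 1 0] I1.n_pos [of 1] I1.p_ge_1 by simp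
  then have l: "0 < l" using size by simp
  have Qf: "(\<lambda>k. Q k y) = smat_vec S (xi p1 w1 n1 y)"
    using assms(12) by (simp add: lin_form_def fun_eq_iff)
  have Qbf: "(\<lambda>k. Qb k x) = smat_vec ?B (xi p2 w2 n2 x)"
    using assms(13) by (simp add: dual_form_def fun_eq_iff)
  show ?thesis
    unfolding CD_kernel_def
  proof (rule CD_band [OF l])
    show "smat_vec J (\<lambda>k. Q k y) k = y * Q k y" for k
      unfolding Qf J I1.conj_shift_eigen [OF lt] by (simp add: Qf [symmetric])
    show "smat_vec (smat_transpose J) (\<lambda>k. Qb k x) k = x * Qb k x" for k
      unfolding Qbf JT I2.conj_shift_eigen [OF lt'] by (simp add: Qbf [symmetric])
    show "(i, j) \<in> sigma1 p1 n1 l" if "j < l" "l \<le> i" "J j i \<noteq> 0" for i j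
      using I1.conj_shift_band [OF lt(1,2)] that size J by blast
    show "(i, j) \<in> sigma2 p2 n2 l" if "i < l" "l \<le> j" "J j i \<noteq> 0" for i j
    proof -
      \<comment> \<open>Entry \<open>(i, j)\<close> of the transpose is \<open>J j i\<close>, so the
        band lemma for the second index system yields the pair in swapped order.\<close>
      have "(?B \<odot> shift_matrix p2 n2 \<odot> smat_transpose Sb) i j \<noteq> 0"
        using that JT [symmetric] by (simp add: smat_transpose_def)
      then have "(j, i) \<in> sigma1 p2 n2 l"
        using I2.conj_shift_band [OF lt'(1,2)] that size by blast
      then show ?thesis by (force simp: sigma2_eq_converse)
    qed
    show "j < l \<and> l \<le> i" if "(i, j) \<in> sigma1 p1 n1 l" for i j
      using that l by (blast dest: sigma1_cutD)
    show "i < l \<and> l \<le> j" if "(i, j) \<in> sigma2 p2 n2 l" for i j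
      using that sigma1_cutD [OF l] by (auto simp: sigma2_eq_converse)
  qed (simp_all add: finite_sigma1 sigma2_eq_converse)
qed

end
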